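(* Suppose the evader wins a discrete-time simple pursuit on a CAT(0) space $X$. Then the total curvature $\tau(t)$ of the pursuit curve from $P_0$ to $P(t)$ is $O(t^{1/2})$ as $t\to\infty$.
   Context: A CAT(0) space is a geodesic metric space $(X,d)$ in which the distance between any two points of any geodesic triangle is at most the distance between the corresponding points of the triangle with the same sidelengths in the Euclidean plane. The angle in $[0,\pi]$ between two geodesic segments from a common point is the limit (= infimum) of the corresponding angles in Euclidean model triangles for initial subsegments. Discrete-time simple pursuit with step size $D>0$: a pursuer $P$ and an evader $E$ start at $P_0,E_0\in X$. At the $i$-th step ($i\ge1$) the evader moves from $E_{i-1}$ to a point $E_i$ of its choice with $d(E_{i-1},E_i)\le D$, and the pursuer moves to $P_i$, the point at distance $D$ from $P_{i-1}$ on the geodesic from $P_{i-1}$ to $E_{i-1}$. Play ends with a win for the pursuer if $d(P_i,E_i)\le D$ for some $i$. The sequence $L_i=d(P_i,E_i)$ is non-increasing. The evader wins if and only if play continues forever and $\lim_{i\to\infty}L_i>D$. The pursuit curve $P(t)$ is the unit-speed curve obtained by joining the successive $P_i$ by geodesic segments, so $P(iD)=P_i$. The total curvature of a polygonal (piecewise-geodesic) curve is $\sum_i(\pi-\beta_i)$ where the $\beta_i$ are the angles at its interior vertices; $\tau(t)$ is the total curvature of $P|_{[0,t]}$. *)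

theory Defs
  imports "HOL-Analysis.Analysis" "HOL-Library.Landau_Symbols"
begin

definition geodesic :: "'a::metric_space set \<Rightarrow> (real \<Rightarrow> 'a) \<Rightarrow> 'a \<Rightarrow> 'a \<Rightarrow> bool" where
  "geodesic X g x y \<longleftrightarrow>
     g ` {0..dist x y} \<subseteq> X \<and> g 0 = x \<and> g (dist x y) = y \<and>
     (\<forall>s\<in>{0..dist x y}. \<forall>t\<in>{0..dist x y}. dist (g s) (g t) = \<bar>s - t\<bar>)"

definition geodesic_space :: "'a::metric_space set \<Rightarrow> bool" where
  "geodesic_space X \<longleftrightarrow> (\<forall>x\<in>X. \<forall>y\<in>X. \<exists>g. geodesic X g x y)"

definition model_triangle ::
    "'a::metric_space \<Rightarrow> 'a \<Rightarrow> 'a \<Rightarrow> real^2 \<Rightarrow> real^2 \<Rightarrow> real^2 \<Rightarrow> bool" where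
  "model_triangle x y z x' y' z' \<longleftrightarrow>
     dist x' y' = dist x y \<and> dist y' z' = dist y z \<and> dist z' x' = dist z x"

(* Pairs of a point on the side g from x to y and the corresponding point on the side from x' to y'
   of the model triangle. For a degenerate side (x = y) the quotient s / 0 = 0 gives x'. *)
definition corresponding_points ::
    "(real \<Rightarrow> 'a::metric_space) \<Rightarrow> 'a \<Rightarrow> 'a \<Rightarrow> real^2 \<Rightarrow> real^2 \<Rightarrow> ('a \<times> (real^2)) set" where
  "corresponding_points g x y x' y' =
     (\<lambda>s. (g s, x' + (s / dist x y) *\<^sub>R (y' - x'))) ` {0..dist x y}"

definition CAT0 :: "'a::metric_space set \<Rightarrow> bool" where
  "CAT0 X \<longleftrightarrow> geodesic_space X \<and>
     (\<forall>x\<in>X. \<forall>y\<in>X. \<forall>z\<in>X. \<forall>g\<^sub>1 g\<^sub>2 g\<^sub>3. \<forall>x' y' z'.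
        geodesic X g\<^sub>1 x y \<longrightarrow> geodesic X g\<^sub>2 y z \<longrightarrow> geodesic X g\<^sub>3 z x \<longrightarrow>
        model_triangle x y z x' y' z' \<longrightarrow>
        (let S = corresponding_points g\<^sub>1 x y x' y' \<union> corresponding_points g\<^sub>2 y z y' z'
                 \<union> corresponding_points g\<^sub>3 z x z' x'
         in \<forall>(u, u')\<in>S. \<forall>(v, v')\<in>S. dist u v \<le> dist u' v'))"

definition euclidean_angle :: "real^2 \<Rightarrow> real^2 \<Rightarrow> real^2 \<Rightarrow> real" where
  "euclidean_angle p x y = arccos (((x - p) \<bullet> (y - p)) / (norm (x - p) * norm (y - p)))"

(* The angle at the first argument. Model triangles exist by the triangle inequality and are unique
   up to isometry, so the description is proper whenever x and y are distinct from p. *)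
definition comparison_angle :: "'a::metric_space \<Rightarrow> 'a \<Rightarrow> 'a \<Rightarrow> real" where
  "comparison_angle p x y =
     (THE a. \<exists>p' x' y'. model_triangle p x y p' x' y' \<and> a = euclidean_angle p' x' y')"

(* For unit-speed geodesics g, h issuing from g 0 = h 0; only their germs at 0 matter.
   In a CAT(0) space the limit exists. *)
definition angle_between :: "(real \<Rightarrow> 'a::metric_space) \<Rightarrow> (real \<Rightarrow> 'a) \<Rightarrow> real" where
  "angle_between g h =
     Lim (at_right 0 \<times>\<^sub>F at_right 0) (\<lambda>(s, t). comparison_angle (g 0) (g s) (h t))"

(* A play that goes on for ever, as it does whenever the evader wins.
   In a CAT(0) space the geodesic g is unique on its domain, so P (Suc i) is determined. *)
definition simple_pursuit ::
    "'a::metric_space set \<Rightarrow> real \<Rightarrow> (nat \<Rightarrow> 'a) \<Rightarrow> (nat \<Rightarrow> 'a) \<Rightarrow> bool" where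
  "simple_pursuit X D P E \<longleftrightarrow>
     P 0 \<in> X \<and> (\<forall>i. E i \<in> X) \<and>
     (\<forall>i. dist (E i) (E (Suc i)) \<le> D) \<and>
     (\<forall>i. \<exists>g. geodesic X g (P i) (E i) \<and>
              P (Suc i) \<in> g ` {0..dist (P i) (E i)} \<and> dist (P i) (P (Suc i)) = D)"

definition evader_wins :: "real \<Rightarrow> (nat \<Rightarrow> 'a::metric_space) \<Rightarrow> (nat \<Rightarrow> 'a) \<Rightarrow> bool" where
  "evader_wins D P E \<longleftrightarrow>
     (\<forall>i. \<not> dist (P i) (E i) \<le> D) \<and> (\<exists>L>D. (\<lambda>i. dist (P i) (E i)) \<longlonglongrightarrow> L)"

(* A curve on [0, infinity); its values at negative times are irrelevant. *)
definition pursuit_curve ::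
    "'a::metric_space set \<Rightarrow> real \<Rightarrow> (nat \<Rightarrow> 'a) \<Rightarrow> (real \<Rightarrow> 'a) \<Rightarrow> bool" where
  "pursuit_curve X D P \<gamma> \<longleftrightarrow>
     (\<forall>i. \<gamma> (real i * D) = P i) \<and>
     (\<forall>i. geodesic X (\<lambda>s. \<gamma> (real i * D + s)) (P i) (P (Suc i)))"

definition vertex_angle :: "(real \<Rightarrow> 'a::metric_space) \<Rightarrow> real \<Rightarrow> real" where
  "vertex_angle \<gamma> u = angle_between (\<lambda>s. \<gamma> (u - s)) (\<lambda>s. \<gamma> (u + s))"

(* The curve restricted to [0, t] is polygonal, its interior vertices being at the parameters
   i * D strictly between 0 and t. *)
definition pursuit_total_curvature :: "real \<Rightarrow> (real \<Rightarrow> 'a::metric_space) \<Rightarrow> real \<Rightarrow> real" where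
  "pursuit_total_curvature D \<gamma> t =
     (\<Sum>i | 0 < real i * D \<and> real i * D < t. pi - vertex_angle \<gamma> (real i * D))"

end

theory Submission
  imports Defs
begin

text \<open>
  Write \<open>l i = dist (P i) (E i)\<close>. At step \<open>i\<close> the pursuer moves to \<open>p = P (i + 1)\<close> on the way to \<open>E i\<close>,
  and then leaves \<open>p\<close> towards \<open>E (i + 1)\<close> instead of going straight on to \<open>E i\<close>. The exterior angle at
  \<open>p\<close> is therefore at most the angle there between the directions of \<open>E i\<close> and \<open>E (i + 1)\<close>, which is at
  most the angle \<open>\<theta>\<close> of the Euclidean triangle with sides \<open>a = l i - D\<close>, \<open>b = l (i + 1)\<close> and third side
  at most \<open>D\<close>. This is \<open>CAT0_turning_angle_le\<close>.

  The drop \<open>\<delta> = l i - l (i + 1)\<close> satisfies \<open>b - a = D - \<delta>\<close>, so the law of cosines bounds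
  \<open>2 a b (1 - cos \<theta>)\<close> by \<open>D\<^sup>2 - (D - \<delta>)\<^sup>2 \<le> 2 D \<delta>\<close>. As the evader wins, \<open>a\<close> and \<open>b\<close> stay away from \<open>0\<close>, and
  \<open>\<theta>\<^sup>2\<close> is at most a constant times \<open>\<delta>\<close> (\<open>pursuit_turning_angle\<close>). The drops telescope, so the squares
  of all exterior angles together have a finite sum, and by the Cauchy--Schwarz inequality the first \<open>n\<close>
  exterior angles add up to at most a constant times \<open>sqrt n\<close>.

  The geometry rests on one consequence of the CAT(0) inequality, \<open>CAT0_hinge\<close>: points on two sides of
  a triangle are at most as far apart as the law of cosines with the Euclidean comparison angle
  predicts. It makes comparison angles monotone, hence convergent to the angle between the sides.
  The inequality for the exterior angle comes from the first variation of distance: if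
  \<open>w\<close> and \<open>h\<close> leave \<open>p\<close> in opposite directions and \<open>k\<close> leaves it at comparison angles \<open>\<beta>\<close> and \<open>\<theta>\<close> to them,
  then for \<open>t\<close> much smaller than \<open>s\<close> the detour from \<open>w s\<close> via \<open>k t\<close> to \<open>h s\<close> has length
  about \<open>2 s - t (cos \<beta> + cos \<theta>)\<close>. It cannot be shorter than \<open>2 s\<close>, so \<open>cos \<beta> + cos \<theta> \<le> 0\<close> in the limit.
\<close>

section \<open>Comparison angles as law-of-cosines quotients\<close>

text \<open>
  The cosine of the comparison angle at \<open>p\<close>, read off from the side lengths by the law of cosines. It
  replaces the comparison angle throughout, because squared distances depend on it linearly.
\<close>

definition comparison_cosine :: "'a::metric_space \<Rightarrow> 'a \<Rightarrow> 'a \<Rightarrow> real" where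
  "comparison_cosine p x y =
     ((dist p x)\<^sup>2 + (dist p y)\<^sup>2 - (dist x y)\<^sup>2) / (2 * dist p x * dist p y)"

lemma law_of_cosines_comparison_cosine:
  assumes "p \<noteq> x" "p \<noteq> y"
  shows "(dist x y)\<^sup>2 =
    (dist p x)\<^sup>2 + (dist p y)\<^sup>2 - 2 * dist p x * dist p y * comparison_cosine p x y"
  using assms by (simp add: comparison_cosine_def field_simps)

text \<open>
  This form of the law of cosines shows the angle to be small when the side opposite to it is hardly
  longer than the difference of the adjacent sides.
\<close>

lemma one_minus_comparison_cosine:
  assumes "p \<noteq> x" "p \<noteq> y"
  shows "1 - comparison_cosine p x y =
    ((dist x y)\<^sup>2 - (dist p x - dist p y)\<^sup>2) / (2 * dist p x * dist p y)"
  using assms by (simp add: comparison_cosine_def field_simps power2_eq_square)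

lemma comparison_cosine_le_1:
  assumes "p \<noteq> x" "p \<noteq> y"
  shows "comparison_cosine p x y \<le> 1"
proof -
  have "\<bar>dist p x - dist p y\<bar> \<le> dist x y"
    by (metis abs_dist_diff_le dist_commute)
  then have "(dist p x - dist p y)\<^sup>2 \<le> (dist x y)\<^sup>2"
    by (simp flip: abs_le_square_iff)
  then have "1 - comparison_cosine p x y \<ge> 0"
    unfolding one_minus_comparison_cosine[OF assms] by (intro divide_nonneg_nonneg) auto
  then show ?thesis by simp
qed

lemma comparison_cosine_ge_minus_1:
  assumes "p \<noteq> x" "p \<noteq> y"
  shows "-1 \<le> comparison_cosine p x y"
proof -
  have "dist x y \<le> dist p x + dist p y"
    by (metis dist_commute dist_triangle)
  then have "(dist x y)\<^sup>2 \<le> (dist p x + dist p y)\<^sup>2"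
    by (intro power_mono) auto
  moreover have "1 + comparison_cosine p x y =
      ((dist p x + dist p y)\<^sup>2 - (dist x y)\<^sup>2) / (2 * dist p x * dist p y)"
    using assms by (simp add: comparison_cosine_def field_simps power2_eq_square)
  ultimately have "1 + comparison_cosine p x y \<ge> 0"
    by (metis diff_ge_0_iff_ge divide_nonneg_nonneg mult_nonneg_nonneg zero_le_dist zero_le_numeral)
  then show ?thesis by simp
qed

text \<open>
  The bounds on the cosine, which express the triangle inequalities, make the square root real that
  is needed to place \<open>y'\<close> when \<open>p'\<close> is the origin and \<open>x'\<close> lies on the first axis.
\<close>

lemma model_triangle_exists:
  assumes "p \<noteq> x" "p \<noteq> y"
  obtains p' x' y' where "model_triangle p x y p' x' y'"
proof -
  define c where "c = comparison_cosine p x y"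
  define x' y' :: "real^2" where "x' = vector [dist p x, 0]"
    and "y' = vector [dist p y * c, dist p y * sqrt (1 - c\<^sup>2)]"
  have c: "-1 \<le> c" "c \<le> 1"
    using assms comparison_cosine_le_1 comparison_cosine_ge_minus_1 by (auto simp: c_def)
  then have s: "(sqrt (1 - c\<^sup>2))\<^sup>2 = 1 - c\<^sup>2"
    by (simp add: abs_square_le_1 abs_le_iff)
  have px: "dist 0 x' = dist p x"
    by (simp add: x'_def norm_vec_def L2_set_def UNIV_2)
  have "(norm y')\<^sup>2 = (dist p y)\<^sup>2"
    by (simp add: y'_def norm_vec_def L2_set_def UNIV_2 power_mult_distrib s algebra_simps)
  then have py: "dist y' 0 = dist y p"
    by (simp add: dist_commute)
  have "(dist x' y')\<^sup>2 = (dist p x - dist p y * c)\<^sup>2 + (dist p y * sqrt (1 - c\<^sup>2))\<^sup>2"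
    by (simp add: x'_def y'_def dist_norm norm_vec_def L2_set_def UNIV_2)
  also have "\<dots> = (dist x y)\<^sup>2"
    unfolding law_of_cosines_comparison_cosine[OF assms, folded c_def] power_mult_distrib s
    by (simp add: power2_eq_square algebra_simps)
  finally have "dist x' y' = dist x y" by simp
  with px py show ?thesis by (intro that[of 0 x' y']) (simp add: model_triangle_def)
qed

lemma euclidean_angle_model_triangle:
  assumes "model_triangle p x y p' x' y'"
  shows "euclidean_angle p' x' y' = arccos (comparison_cosine p x y)"
proof -
  have "(x' - p') \<bullet> (y' - p') = ((norm (x' - p'))\<^sup>2 + (norm (y' - p'))\<^sup>2 - (dist x' y')\<^sup>2) / 2"
    by (simp add: dist_norm power2_norm_eq_inner inner_diff inner_commute algebra_simps)
  moreover have "norm (x' - p') = dist p x" "norm (y' - p') = dist p y" "dist x' y' = dist x y"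
    using assms by (auto simp: model_triangle_def dist_commute simp flip: dist_norm)
  ultimately show ?thesis
    unfolding euclidean_angle_def comparison_cosine_def by (simp only:) (simp add: mult.assoc)
qed

lemma comparison_angle_eq_arccos:
  assumes "p \<noteq> x" "p \<noteq> y"
  shows "comparison_angle p x y = arccos (comparison_cosine p x y)"
proof -
  obtain p' x' y' where "model_triangle p x y p' x' y'" by (rule model_triangle_exists[OF assms])
  then show ?thesis
    unfolding comparison_angle_def
    by (intro the_equality) (use euclidean_angle_model_triangle in \<open>metis+\<close>)
qed

section \<open>Geodesics and hinge comparison\<close>

lemma geodesic_dist_eq:
  assumes "geodesic X g x y" "s \<in> {0..dist x y}" "t \<in> {0..dist x y}"
  shows "dist (g s) (g t) = \<bar>s - t\<bar>"
  using assms by (simp add: geodesic_def)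

lemma geodesic_dist_start:
  assumes "geodesic X g x y" "0 \<le> s" "s \<le> dist x y"
  shows "dist x (g s) = s"
  using geodesic_dist_eq[OF assms(1), of 0 s] assms by (simp add: geodesic_def)

lemma geodesic_dist_end:
  assumes "geodesic X g x y" "0 \<le> s" "s \<le> dist x y"
  shows "dist (g s) y = dist x y - s"
  using geodesic_dist_eq[OF assms(1), of s "dist x y"] assms by (simp add: geodesic_def)

lemma geodesic_initial_segment:
  assumes "geodesic X g x y" "0 \<le> s" "s \<le> dist x y"
  shows "geodesic X g x (g s)"
  using assms geodesic_dist_start[OF assms] by (auto simp: geodesic_def image_subset_iff)

lemma geodesic_final_segment:
  assumes "geodesic X g x y" "0 \<le> s" "s \<le> dist x y"
  shows "geodesic X (\<lambda>r. g (s + r)) (g s) y"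
  using assms geodesic_dist_end[OF assms] by (auto simp: geodesic_def image_subset_iff)

lemma geodesic_reverse:
  assumes "geodesic X g x y"
  shows "geodesic X (\<lambda>s. g (dist x y - s)) y x"
  using assms by (auto simp: geodesic_def image_subset_iff dist_commute[of y x])

text \<open>
  Replacing an initial part of a geodesic by another geodesic with the same endpoints leaves a path
  of the same total length, and a path whose length is the distance of its ends is a geodesic.
\<close>

lemma geodesic_replace_initial:
  assumes g: "geodesic X g x y" and a: "geodesic X a x p"
    and p: "p = g (dist x p)" "dist x p \<le> dist x y"
  shows "geodesic X (\<lambda>s. if s \<le> dist x p then a s else g s) x y"
    (is "geodesic X ?b x y")
proof -
  have cross: "dist (a s) (g t) = t - s" if "0 \<le> s" "s \<le> dist x p" "dist x p \<le> t" "t \<le> dist x y" for s t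
  proof -
    have "dist (a s) p = dist x p - s" "dist x (a s) = s" "dist x (g t) = t"
      using that geodesic_dist_end[OF a] geodesic_dist_start[OF a] geodesic_dist_start[OF g]
        zero_le_dist[of x p] by auto
    moreover have "dist p (g t) = t - dist x p"
      using geodesic_dist_eq[OF g, of "dist x p" t] p that by auto
    ultimately show ?thesis
      using dist_triangle[of "a s" "g t" p] dist_triangle[of x "g t" "a s"] by linarith
  qed
  have "dist (?b s) (?b t) = \<bar>s - t\<bar>" if "s \<in> {0..dist x y}" "t \<in> {0..dist x y}" for s t
    using that cross[of s t] cross[of t s] geodesic_dist_eq[OF g, of s t] geodesic_dist_eq[OF a, of s t]
    by (auto simp: dist_commute)
  moreover have "?b (dist x y) = y"
  proof (cases "dist x y \<le> dist x p")
    case True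
    with p(2) have eq: "dist x p = dist x y" by simp
    have "p = y" using p(1) g unfolding eq by (simp add: geodesic_def)
    with a show ?thesis by (simp add: geodesic_def)
  qed (use g in \<open>simp add: geodesic_def\<close>)
  moreover have "?b 0 = x" "?b ` {0..dist x y} \<subseteq> X"
    using g a unfolding geodesic_def by (auto simp: image_subset_iff)
  ultimately show ?thesis unfolding geodesic_def by blast
qed

lemma geodesic_endpoints_in:
  assumes "geodesic X g x y"
  shows "x \<in> X" "y \<in> X"
proof -
  have "g 0 \<in> X" "g (dist x y) \<in> X"
    using assms unfolding geodesic_def by (meson atLeastAtMost_iff image_subset_iff order_refl zero_le_dist)+
  then show "x \<in> X" "y \<in> X" using assms by (simp_all add: geodesic_def)
qed

lemma norm_diff_scaled_sides:
  fixes u v :: "'b::real_inner"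
  assumes "a > 0" "b > 0" "norm u = a" "norm v = b"
  shows "(norm ((r / a) *\<^sub>R u - (t / b) *\<^sub>R v))\<^sup>2
    = r\<^sup>2 + t\<^sup>2 - r * t * ((a\<^sup>2 + b\<^sup>2 - (norm (u - v))\<^sup>2) / (a * b))"
proof -
  have uu: "u \<bullet> u = a\<^sup>2" "v \<bullet> v = b\<^sup>2"
    using assms by (metis power2_norm_eq_inner)+
  have uv: "(norm (u - v))\<^sup>2 = a\<^sup>2 + b\<^sup>2 - 2 * (u \<bullet> v)"
    by (simp add: power2_norm_eq_inner inner_diff inner_commute flip: uu)
  have "(norm ((r / a) *\<^sub>R u - (t / b) *\<^sub>R v))\<^sup>2
      = (r / a)\<^sup>2 * (u \<bullet> u) + (t / b)\<^sup>2 * (v \<bullet> v) - 2 * (r / a) * (t / b) * (u \<bullet> v)"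
    unfolding power2_norm_eq_inner by (simp add: inner_diff inner_commute power2_eq_square)
  also have "\<dots> = r\<^sup>2 + t\<^sup>2 - r * t * ((a\<^sup>2 + b\<^sup>2 - (norm (u - v))\<^sup>2) / (a * b))"
    unfolding uu uv using assms(1,2) by (simp add: power_divide)
  finally show ?thesis .
qed

text \<open>
  The CAT(0) inequality for points on the two sides issuing from \<open>p\<close>, with the Euclidean distance of the
  corresponding points evaluated.
\<close>

lemma CAT0_hinge:
  assumes "CAT0 X" "geodesic X h p x" "geodesic X k p y" "p \<noteq> x" "p \<noteq> y"
    and r: "0 \<le> r" "r \<le> dist p x" and t: "0 \<le> t" "t \<le> dist p y"
  shows "(dist (h r) (k t))\<^sup>2 \<le> r\<^sup>2 + t\<^sup>2 - 2 * r * t * comparison_cosine p x y"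
proof -
  \<comment> \<open>In the CAT(0) condition the third side runs from \<open>y\<close> back to \<open>p\<close>, so \<open>k\<close> enters reversed.\<close>
  let ?k = "\<lambda>s. k (dist p y - s)"
  obtain p' x' y' where M: "model_triangle p x y p' x' y'"
    using model_triangle_exists assms by metis
  have X: "p \<in> X" "x \<in> X" "y \<in> X"
    using assms geodesic_endpoints_in by metis+
  obtain g where g: "geodesic X g x y"
    using assms(1) X unfolding CAT0_def geodesic_space_def by metis
  define S where "S = corresponding_points h p x p' x' \<union> corresponding_points g x y x' y'
                 \<union> corresponding_points ?k y p y' p'"
  have C: "\<forall>(u, u')\<in>S. \<forall>(v, v')\<in>S. dist u v \<le> dist u' v'"
    using assms(1) X assms(2) g geodesic_reverse[OF assms(3)] M
    unfolding CAT0_def Let_def S_def by meson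
  have A: "(h r, p' + (r / dist p x) *\<^sub>R (x' - p')) \<in> S"
    unfolding S_def corresponding_points_def using r by auto
  have "(?k (dist p y - t), y' + ((dist p y - t) / dist y p) *\<^sub>R (p' - y'))
      \<in> corresponding_points ?k y p y' p'"
    unfolding corresponding_points_def using t by (intro image_eqI[OF refl]) (auto simp: dist_commute)
  moreover have "y' + ((dist p y - t) / dist y p) *\<^sub>R (p' - y') = p' + (t / dist p y) *\<^sub>R (y' - p')"
    using \<open>p \<noteq> y\<close> by (simp add: dist_commute diff_divide_distrib algebra_simps)
  ultimately have B: "(k t, p' + (t / dist p y) *\<^sub>R (y' - p')) \<in> S"
    unfolding S_def by simp
  have "dist (h r) (k t) \<le> dist (p' + (r / dist p x) *\<^sub>R (x' - p')) (p' + (t / dist p y) *\<^sub>R (y' - p'))"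
    using C A B by fast
  also have "\<dots> = norm ((r / dist p x) *\<^sub>R (x' - p') - (t / dist p y) *\<^sub>R (y' - p'))"
    by (simp add: dist_norm)
  finally have "(dist (h r) (k t))\<^sup>2
      \<le> (norm ((r / dist p x) *\<^sub>R (x' - p') - (t / dist p y) *\<^sub>R (y' - p')))\<^sup>2"
    by (intro power_mono) auto
  also have "\<dots> = r\<^sup>2 + t\<^sup>2 - 2 * r * t * comparison_cosine p x y"
  proof -
    have "norm (x' - p') = dist p x" "norm (y' - p') = dist p y"
      and "norm (x' - p' - (y' - p')) = dist x y"
      using M by (auto simp: model_triangle_def dist_commute simp flip: dist_norm)
    then show ?thesis
      using assms norm_diff_scaled_sides[of "dist p x" "dist p y" "x' - p'" "y' - p'" r t]
      by (simp add: comparison_cosine_def)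
  qed
  finally show ?thesis .
qed

lemma geodesic_point_neq_start:
  assumes "geodesic X g x y" "0 < s" "s \<le> dist x y"
  shows "x \<noteq> g s"
  using geodesic_dist_start[OF assms(1), of s] assms by auto

text \<open>
  Hinge comparison in the triangle \<open>p, h s', k t'\<close>: comparison angles do not increase as the points move
  towards \<open>p\<close>.
\<close>

lemma comparison_cosine_antimono:
  assumes "CAT0 X" "geodesic X h p x" "geodesic X k p y"
    and s: "0 < s" "s \<le> s'" "s' \<le> dist p x" and t: "0 < t" "t \<le> t'" "t' \<le> dist p y"
  shows "comparison_cosine p (h s') (k t') \<le> comparison_cosine p (h s) (k t)"
proof -
  have d: "dist p (h s') = s'" "dist p (h s) = s" "dist p (k t) = t" "dist p (k t') = t'"
    using assms geodesic_dist_start[of X h p x] geodesic_dist_start[of X k p y] by auto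
  have n: "p \<noteq> h s'" "p \<noteq> h s" "p \<noteq> k t" "p \<noteq> k t'"
    using assms geodesic_point_neq_start[of X h p x] geodesic_point_neq_start[of X k p y] by auto
  have "(dist (h s) (k t))\<^sup>2 \<le> s\<^sup>2 + t\<^sup>2 - 2 * s * t * comparison_cosine p (h s') (k t')"
    using assms n d
    by (intro CAT0_hinge[OF assms(1), of h p _ k] geodesic_initial_segment[OF assms(2)]
        geodesic_initial_segment[OF assms(3)]) auto
  then have "2 * s * t * comparison_cosine p (h s') (k t') \<le> 2 * s * t * comparison_cosine p (h s) (k t)"
    using law_of_cosines_comparison_cosine[OF n(2,3)] d by simp
  then show ?thesis using s t by (simp add: mult_le_cancel_left_pos)
qed

section \<open>The angle between geodesics\<close>

text \<open>
  A function of two positive arguments that grows as either one shrinks, but stays bounded, converges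
  to its supremum at the corner.
\<close>

lemma tendsto_at_right_0_antimono2:
  fixes F :: "real \<Rightarrow> real \<Rightarrow> real"
  assumes "0 < a" "0 < b"
    and mono: "\<And>s s' t t'. \<lbrakk>0 < s; s \<le> s'; s' \<le> a; 0 < t; t \<le> t'; t' \<le> b\<rbrakk> \<Longrightarrow> F s' t' \<le> F s t"
    and bound: "\<And>s t. \<lbrakk>0 < s; s \<le> a; 0 < t; t \<le> b\<rbrakk> \<Longrightarrow> F s t \<le> B"
  obtains M where "((\<lambda>(s, t). F s t) \<longlongrightarrow> M) (at_right 0 \<times>\<^sub>F at_right 0)" "F a b \<le> M" "M \<le> B"
proof -
  define I where "I = {0<..a} \<times> {0<..b}"
  define M where "M = (SUP (s, t)\<in>I. F s t)"
  have ab: "(a, b) \<in> I" using assms by (simp add: I_def)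
  then have ne: "I \<noteq> {}" by auto
  have bdd: "bdd_above ((\<lambda>(s, t). F s t) ` I)"
    using bound by (intro bdd_aboveI[of _ B]) (auto simp: I_def)
  have le_M: "F s t \<le> M" if "(s, t) \<in> I" for s t
    using cSUP_upper[OF that bdd] by (simp add: M_def)
  have ev: "\<forall>\<^sub>F z in at_right 0 \<times>\<^sub>F at_right 0. z \<in> {0<..<s} \<times> {0<..<t}"
    if "0 < s" "0 < t" for s t :: real
  proof -
    have "eventually (\<lambda>u. u \<in> {0<..<s}) (at_right 0)" "eventually (\<lambda>u. u \<in> {0<..<t}) (at_right 0)"
      using that eventually_at_right_real by auto
    then show ?thesis
      unfolding eventually_prod_filter by (intro exI conjI) (assumption, assumption, auto)
  qed
  have "((\<lambda>(s, t). F s t) \<longlongrightarrow> M) (at_right 0 \<times>\<^sub>F at_right 0)"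
  proof (rule order_tendstoI)
    fix l assume "l < M"
    then obtain s t where st: "(s, t) \<in> I" "l < F s t"
      using less_cSUP_iff[OF ne bdd, of l] unfolding M_def by auto
    show "\<forall>\<^sub>F z in at_right 0 \<times>\<^sub>F at_right 0. l < (case z of (s, t) \<Rightarrow> F s t)"
    proof (intro eventually_mono[OF ev[of s t]])
      show "0 < s" "0 < t" using st by (auto simp: I_def)
      fix z assume "z \<in> {0<..<s} \<times> {0<..<t}"
      then have "F s t \<le> F (fst z) (snd z)" using st by (intro mono) (auto simp: I_def)
      with st(2) show "l < (case z of (s, t) \<Rightarrow> F s t)" by (simp add: split_beta)
    qed
  next
    fix l assume "M < l"
    then show "\<forall>\<^sub>F z in at_right 0 \<times>\<^sub>F at_right 0. (case z of (s, t) \<Rightarrow> F s t) < l"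
    proof (intro eventually_mono[OF ev[OF assms(1,2)]])
      fix z :: "real \<times> real" assume "z \<in> {0<..<a} \<times> {0<..<b}"
      then have "F (fst z) (snd z) \<le> M" by (intro le_M) (auto simp: I_def)
      with \<open>M < l\<close> show "(case z of (s, t) \<Rightarrow> F s t) < l" by (simp add: split_beta)
    qed
  qed
  moreover have "F a b \<le> M" using le_M ab by simp
  moreover have "M \<le> B"
    unfolding M_def using ab bound by (intro cSUP_least) (auto simp: I_def)
  ultimately show ?thesis by (rule that)
qed

text \<open>
  Angles between geodesics are defined as a \<open>Lim\<close>, which says something only if the limit exists.
  Monotonicity of the comparison cosine provides this.
\<close>

lemma CAT0_angle_exists:
  assumes "CAT0 X" "geodesic X h p x" "geodesic X k p y" "p \<noteq> x" "p \<noteq> y"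
  obtains c where "((\<lambda>(s, t). comparison_cosine p (h s) (k t)) \<longlongrightarrow> c) (at_right 0 \<times>\<^sub>F at_right 0)"
    and "-1 \<le> c" "c \<le> 1" "angle_between h k = arccos c"
proof -
  define C where "C s t = comparison_cosine p (h s) (k t)" for s t
  let ?F = "at_right 0 \<times>\<^sub>F at_right 0 :: (real \<times> real) filter"
  have pos: "0 < dist p x" "0 < dist p y" using assms by auto
  have neq: "p \<noteq> h s" "p \<noteq> k t" if "0 < s" "s \<le> dist p x" "0 < t" "t \<le> dist p y" for s t
    using that geodesic_point_neq_start[OF assms(2)] geodesic_point_neq_start[OF assms(3)] by blast+
  have C1: "C s t \<le> 1" "-1 \<le> C s t" if "0 < s" "s \<le> dist p x" "0 < t" "t \<le> dist p y" for s t
    unfolding C_def using neq[OF that] by (simp_all add: comparison_cosine_le_1 comparison_cosine_ge_minus_1)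
  obtain c where c: "((\<lambda>(s, t). C s t) \<longlongrightarrow> c) ?F" "C (dist p x) (dist p y) \<le> c" "c \<le> 1"
    by (rule tendsto_at_right_0_antimono2[of "dist p x" "dist p y" C 1])
       (use pos C1 comparison_cosine_antimono[OF assms(1-3)] in \<open>auto simp: C_def\<close>)
  have c': "-1 \<le> c" using c(2) C1(2)[of "dist p x" "dist p y"] pos by linarith
  have ev: "\<forall>\<^sub>F z in ?F. 0 < fst z \<and> fst z < dist p x \<and> 0 < snd z \<and> snd z < dist p y"
  proof -
    have "eventually (\<lambda>u. u \<in> {0<..<dist p x}) (at_right 0)"
      "eventually (\<lambda>u. u \<in> {0<..<dist p y}) (at_right 0)"
      using pos eventually_at_right_real by auto
    then show ?thesis
      unfolding eventually_prod_filter by (intro exI conjI) (assumption, assumption, auto)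
  qed
  have "((\<lambda>z. arccos ((\<lambda>(s, t). C s t) z)) \<longlongrightarrow> arccos c) ?F"
    by (rule continuous_on_tendsto_compose[OF continuous_on_arccos' c(1)])
       (use c c' C1 in \<open>auto intro!: eventually_mono[OF ev]\<close>)
  moreover have "\<forall>\<^sub>F z in ?F. arccos ((\<lambda>(s, t). C s t) z)
      = (\<lambda>(s, t). comparison_angle (h 0) (h s) (k t)) z"
  proof (rule eventually_mono[OF ev])
    fix z assume "0 < fst z \<and> fst z < dist p x \<and> 0 < snd z \<and> snd z < dist p y"
    then have "p \<noteq> h (fst z)" "p \<noteq> k (snd z)" using neq[of "fst z" "snd z"] by auto
    moreover have "h 0 = p" using assms(2) by (simp add: geodesic_def)
    ultimately show "arccos ((\<lambda>(s, t). C s t) z) = (\<lambda>(s, t). comparison_angle (h 0) (h s) (k t)) z"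
      by (simp add: C_def split_beta comparison_angle_eq_arccos)
  qed
  ultimately have "((\<lambda>(s, t). comparison_angle (h 0) (h s) (k t)) \<longlongrightarrow> arccos c) ?F"
    by (rule Lim_transform_eventually)
  then have "angle_between h k = arccos c"
    unfolding angle_between_def
    by (intro tendsto_Lim) (auto simp: prod_filter_eq_bot trivial_limit_at_right_real)
  with c c' show ?thesis by (intro that[of c]) (auto simp: C_def)
qed

lemma angle_between_cong_germ:
  assumes "0 < e" "\<And>t. \<lbrakk>0 < t; t < e\<rbrakk> \<Longrightarrow> h t = h' t"
  shows "angle_between g h = angle_between g h'"
proof -
  have "eventually (\<lambda>t. t \<in> {0<..<e}) (at_right 0)" using assms(1) by (rule eventually_at_right_real)
  then have "\<forall>\<^sub>F t in at_right 0. h t = h' t" by (rule eventually_mono) (auto simp: assms(2))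
  then have "\<forall>\<^sub>F z in at_right (0::real) \<times>\<^sub>F at_right 0. h (snd z) = h' (snd z)"
    unfolding eventually_prod_filter by (intro exI[of _ "\<lambda>_. True"] exI conjI) auto
  then have "\<forall>\<^sub>F z in at_right 0 \<times>\<^sub>F at_right 0. (\<lambda>(s, t). comparison_angle (g 0) (g s) (h t)) z
      = (\<lambda>(s, t). comparison_angle (g 0) (g s) (h' t)) z"
    by (rule eventually_mono) auto
  from tendsto_cong[OF this] show ?thesis by (simp add: angle_between_def Topological_Spaces.Lim_def)
qed

text \<open>
  A one-sided first-order expansion for small \<open>t / s\<close>, from \<open>sqrt (A\<^sup>2 + B) \<le> A + B / (2 A)\<close> with
  \<open>A = s - t * c\<close>: in a Euclidean triangle, moving one end of a side of length \<open>s\<close> by \<open>t\<close>, at an angle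
  to the side whose cosine is \<open>c\<close>, changes its length by \<open>- t * c\<close> up to second order.
\<close>

lemma real_le_first_variation:
  fixes d :: real
  assumes "d\<^sup>2 \<le> s\<^sup>2 + t\<^sup>2 - 2 * s * t * c" "0 < t" "t < s" "c \<le> 1" "0 \<le> d"
  shows "d \<le> s - t * c + t\<^sup>2 / (2 * (s - t))"
proof -
  have pos: "0 < s - t" "s - t \<le> s - t * c" using assms by auto
  let ?e = "t\<^sup>2 / (2 * (s - t))"
  have "d\<^sup>2 \<le> (s - t * c)\<^sup>2 + t\<^sup>2 - (t * c)\<^sup>2"
    using assms by (simp add: power2_eq_square algebra_simps)
  also have "\<dots> \<le> (s - t * c)\<^sup>2 + t\<^sup>2" by simp
  also have "t\<^sup>2 = 2 * (s - t) * ?e" using pos by simp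
  also have "(s - t * c)\<^sup>2 + \<dots> \<le> (s - t * c)\<^sup>2 + ?e\<^sup>2 + 2 * (s - t * c) * ?e"
  proof -
    have "2 * (s - t) * ?e \<le> 2 * (s - t * c) * ?e"
      using pos by (intro mult_right_mono) auto
    then show ?thesis by (smt (verit) zero_le_power2)
  qed
  also have "\<dots> = (s - t * c + ?e)\<^sup>2" by (rule power2_sum[symmetric])
  finally have "d\<^sup>2 \<le> (s - t * c + ?e)\<^sup>2" .
  moreover have "0 \<le> s - t * c + ?e" using pos by simp
  ultimately show ?thesis by (rule power2_le_imp_le)
qed

text \<open>
  Since \<open>w\<close> and \<open>h\<close> together form a geodesic through \<open>p\<close>, the detour from \<open>w s\<close> to \<open>h s\<close> via \<open>k t\<close> has length
  at least \<open>2 * s\<close>. The first variation bounds both halves of the detour from above. The comparison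
  cosine on the side of \<open>h\<close> may be taken for the whole triangle, by hinge comparison.
\<close>

lemma CAT0_supplementary_cosines_le:
  assumes "CAT0 X" "geodesic X w p x" "geodesic X h p y" "geodesic X k p z"
    and ne: "p \<noteq> x" "p \<noteq> y" "p \<noteq> z"
    and straight: "dist x y = dist x p + dist p y"
    and s: "0 < s" "s \<le> dist p x" "s \<le> dist p y" and t: "0 < t" "t < s" "t \<le> dist p z"
  shows "comparison_cosine p (w s) (k t) + comparison_cosine p y z \<le> t / (s - t)"
proof -
  define c where "c = comparison_cosine p (w s) (k t)"
  define c' where "c' = comparison_cosine p y z"
  have d: "dist p (w s) = s" "dist p (k t) = t" "dist (w s) x = dist p x - s"
    "dist (h s) y = dist p y - s"
    using assms by (auto simp: geodesic_dist_start geodesic_dist_end)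
  have n: "p \<noteq> w s" "p \<noteq> k t" using d s t by force+
  have b: "-1 \<le> c" "c \<le> 1" "-1 \<le> c'" "c' \<le> 1"
    using n ne by (auto simp: c_def c'_def comparison_cosine_le_1 comparison_cosine_ge_minus_1)
  have "dist (w s) (k t) \<le> s - t * c + t\<^sup>2 / (2 * (s - t))"
    using law_of_cosines_comparison_cosine[OF n] d b t
    by (intro real_le_first_variation) (auto simp: c_def)
  moreover have "dist (h s) (k t) \<le> s - t * c' + t\<^sup>2 / (2 * (s - t))"
    using CAT0_hinge[OF assms(1) assms(3,4) ne(2,3), of s t] s t b
    by (intro real_le_first_variation) (auto simp: c'_def)
  moreover have "2 * s \<le> dist (w s) (k t) + dist (h s) (k t)"
  proof -
    have "dist x y \<le> dist (w s) x + dist (w s) (k t) + dist (h s) (k t) + dist (h s) y"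
      by (smt (verit) dist_commute dist_triangle)
    then show ?thesis using straight d by (simp add: dist_commute)
  qed
  ultimately have "t * (c + c') \<le> 2 * (t\<^sup>2 / (2 * (s - t)))" by (simp add: algebra_simps)
  also have "\<dots> = t * (t / (s - t))" using t by (simp add: field_simps power2_eq_square)
  finally have "c + c' \<le> t / (s - t)" using t(1) by (simp only: mult_le_cancel_left_pos)
  then show ?thesis by (simp add: c_def c'_def)
qed

text \<open>
  A path that follows a geodesic from \<open>x\<close> to \<open>p\<close> and then turns towards \<open>z\<close>, instead of going straight on to
  \<open>y\<close>, has an exterior angle of at most the comparison angle of \<open>y\<close> and \<open>z\<close>. The bound with fixed \<open>s\<close> and \<open>t\<close>
  is passed to the limit.
\<close>

lemma CAT0_turning_angle_le:
  assumes "CAT0 X" "geodesic X w p x" "geodesic X h p y" "geodesic X k p z"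
    and ne: "p \<noteq> x" "p \<noteq> y" "p \<noteq> z"
    and straight: "dist x y = dist x p + dist p y"
  shows "pi - angle_between w k \<le> arccos (comparison_cosine p y z)"
    and "angle_between w k \<le> pi"
proof -
  define c' where "c' = comparison_cosine p y z"
  obtain c where c: "((\<lambda>(s, t). comparison_cosine p (w s) (k t)) \<longlongrightarrow> c) (at_right 0 \<times>\<^sub>F at_right 0)"
    and b: "-1 \<le> c" "c \<le> 1" and a: "angle_between w k = arccos c"
    using CAT0_angle_exists[OF assms(1,2,4) ne(1,3)] by metis
  have b': "-1 \<le> c'" "c' \<le> 1"
    using ne by (auto simp: c'_def comparison_cosine_le_1 comparison_cosine_ge_minus_1)
  \<comment> \<open>Along \<open>t = s\<^sup>2\<close> both arguments tend to \<open>0\<close>, and so does the error term \<open>t / (s - t) = s / (1 - s)\<close>.\<close>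
  have sq: "filterlim (\<lambda>s::real. s\<^sup>2) (at_right 0) (at_right 0)"
  proof -
    have "((\<lambda>s::real. s\<^sup>2) \<longlongrightarrow> 0\<^sup>2) (at_right 0)" by (intro tendsto_intros)
    then show ?thesis
      by (simp add: filterlim_at eventually_at_right_less eventually_at_filter)
  qed
  have lim: "((\<lambda>s. comparison_cosine p (w s) (k (s\<^sup>2)) + c') \<longlongrightarrow> c + c') (at_right 0)"
    using filterlim_compose[OF c filterlim_Pair[OF filterlim_ident sq]] by (intro tendsto_intros) simp
  have lim0: "((\<lambda>s::real. s / (1 - s)) \<longlongrightarrow> 0 / (1 - 0)) (at_right 0)"
    by (intro tendsto_intros) auto
  define m where "m = min (1/2) (min (dist p x) (min (dist p y) (dist p z)))"
  have "m > 0" using ne by (simp add: m_def)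
  then have "\<forall>\<^sub>F s in at_right 0. s \<in> {0<..<m}" by (rule eventually_at_right_real)
  then have "\<forall>\<^sub>F s in at_right 0. comparison_cosine p (w s) (k (s\<^sup>2)) + c' \<le> s / (1 - s)"
  proof (rule eventually_mono)
    fix s assume "s \<in> {0<..<m}"
    then have s: "0 < s" "s < 1/2" "s < dist p x" "s < dist p y" "s < dist p z" by (auto simp: m_def)
    have "s\<^sup>2 < s" using s by (simp add: power2_eq_square)
    then have "comparison_cosine p (w s) (k (s\<^sup>2)) + c' \<le> s\<^sup>2 / (s - s\<^sup>2)"
      unfolding c'_def using s by (intro CAT0_supplementary_cosines_le[OF assms]) auto
    also have "\<dots> = s / (1 - s)" using s by (simp add: field_simps power2_eq_square)
    finally show "comparison_cosine p (w s) (k (s\<^sup>2)) + c' \<le> s / (1 - s)" .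
  qed
  then have "c + c' \<le> 0 / (1 - 0)"
    by (intro tendsto_le[OF trivial_limit_at_right_real lim0 lim])
  then have "arccos (- c') \<le> arccos c" using b b' by (intro arccos_le_arccos) auto
  then show "pi - angle_between w k \<le> arccos (comparison_cosine p y z)"
    using b' by (simp add: arccos_minus a c'_def)
  show "angle_between w k \<le> pi" using a b by (simp add: arccos_ubound)
qed

section \<open>Total curvature of pursuit curves\<close>

text \<open>
  For an angle \<open>\<theta>\<close> in \<open>[0, \<pi>]\<close>, \<open>1 - cos \<theta> = 2 sin\<^sup>2 (\<theta> / 2)\<close>, and \<open>sin x \<ge> x - x\<^sup>3 / 6 \<ge> x / 3\<close> for \<open>0 \<le> x \<le> 2\<close>.
\<close>

lemma arccos_squared_le:
  assumes "-1 \<le> c" "c \<le> 1"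
  shows "(arccos c)\<^sup>2 \<le> 18 * (1 - c)"
proof -
  define x where "x = arccos c / 2"
  have x: "0 \<le> x" "x \<le> 2"
    using assms arccos_lbound[of c] arccos_ubound[of c] pi_less_4 by (auto simp: x_def)
  have "\<bar>sin x - x\<bar> \<le> x ^ 3 / 6"
    using Maclaurin_sin_bound[of x 3] x
    by (simp add: sin_coeff_def eval_nat_numeral divide_simps split: if_splits)
  moreover have "x ^ 3 / 6 \<le> 2 / 3 * x"
  proof -
    have "x * x\<^sup>2 \<le> x * 2\<^sup>2" using x by (intro mult_left_mono power_mono) auto
    then show ?thesis by (simp add: power3_eq_cube power2_eq_square)
  qed
  ultimately have "x / 3 \<le> sin x" by linarith
  then have "(x / 3)\<^sup>2 \<le> (sin x)\<^sup>2" using x by (intro power_mono) auto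
  moreover have "1 - c = 2 * (sin x)\<^sup>2"
    using cos_double_sin[of x] assms by (simp add: x_def)
  ultimately have "2 * (x / 3)\<^sup>2 \<le> 1 - c" by simp
  then show ?thesis by (simp add: x_def power_divide)
qed

lemma pursuit_step_geodesic:
  assumes "simple_pursuit X D P E"
  obtains g where "geodesic X g (P i) (E i)" "P (Suc i) = g D" "0 \<le> D" "D \<le> dist (P i) (E i)"
    "dist (P i) (P (Suc i)) = D" "dist (P (Suc i)) (E i) = dist (P i) (E i) - D"
    "dist (E i) (E (Suc i)) \<le> D"
proof -
  obtain g s where g: "geodesic X g (P i) (E i)" "P (Suc i) = g s" "0 \<le> s" "s \<le> dist (P i) (E i)"
    and D: "dist (P i) (P (Suc i)) = D" "dist (E i) (E (Suc i)) \<le> D"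
  proof -
    have D: "dist (E i) (E (Suc i)) \<le> D" using assms by (simp add: simple_pursuit_def)
    obtain g where g: "geodesic X g (P i) (E i)" "P (Suc i) \<in> g ` {0..dist (P i) (E i)}"
      "dist (P i) (P (Suc i)) = D"
      using assms unfolding simple_pursuit_def by blast
    from g(2) obtain s where "P (Suc i) = g s" "s \<in> {0..dist (P i) (E i)}" by (rule imageE)
    then show ?thesis by (intro that[OF g(1) _ _ _ g(3) D, of s]) simp_all
  qed
  moreover have "s = D" using geodesic_dist_start[OF g(1,3,4)] g D by simp
  moreover have "dist (g s) (E i) = dist (P i) (E i) - s" by (rule geodesic_dist_end[OF g(1,3,4)])
  ultimately show ?thesis by (intro that[of g]) simp_all
qed

text \<open>
  The pursuer gains exactly \<open>D\<close> on the old position of the evader, who then regains at most \<open>D\<close>.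
\<close>

lemma pursuit_distance_decseq:
  assumes "simple_pursuit X D P E"
  shows "decseq (\<lambda>i. dist (P i) (E i))"
proof (rule decseq_SucI)
  fix i
  have "dist (P (Suc i)) (E i) = dist (P i) (E i) - D" "dist (E i) (E (Suc i)) \<le> D"
    by (rule pursuit_step_geodesic[OF assms, of i]; simp)+
  then show "dist (P (Suc i)) (E (Suc i)) \<le> dist (P i) (E i)"
    using dist_triangle[of "P (Suc i)" "E (Suc i)" "E i"] by linarith
qed

text \<open>
  The exterior angle is at most the comparison angle at \<open>P (Suc i)\<close> of the old and the new position of
  the evader. The two sides there have lengths at least \<open>L - D\<close> and \<open>L\<close>, and their difference is \<open>D\<close> less
  the drop of the distance, whereas the third side is at most \<open>D\<close>.
\<close>

lemma pursuit_turning_angle: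
  fixes i :: nat
  assumes X: "CAT0 X" "D > 0" and S: "simple_pursuit X D P E"
    and C: "pursuit_curve X D P \<gamma>"
    and L: "(\<lambda>i. dist (P i) (E i)) \<longlonglongrightarrow> L" "D < L"
  defines "\<beta> \<equiv> vertex_angle \<gamma> (real (Suc i) * D)"
  shows "0 \<le> pi - \<beta>"
    and "(pi - \<beta>)\<^sup>2 \<le> 18 * D / ((L - D) * L) * (dist (P i) (E i) - dist (P (Suc i)) (E (Suc i)))"
proof -
  let ?p = "P (Suc i)"
  define u where "u = real (Suc i) * D"
  define a b where "a = dist ?p (E i)" and "b = dist ?p (E (Suc i))"
  have dec: "decseq (\<lambda>i. dist (P i) (E i))" by (rule pursuit_distance_decseq[OF S])
  obtain g where g: "geodesic X g (P i) (E i)" "?p = g D" "0 \<le> D" "D \<le> dist (P i) (E i)"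
    "dist (P i) ?p = D" "a = dist (P i) (E i) - D" "dist (E i) (E (Suc i)) \<le> D"
    unfolding a_def by (rule pursuit_step_geodesic[OF S])
  obtain g' where g': "geodesic X g' ?p (E (Suc i))" "P (Suc (Suc i)) = g' D" "D \<le> dist ?p (E (Suc i))"
    "dist ?p (P (Suc (Suc i))) = D"
    by (rule pursuit_step_geodesic[OF S, where i = "Suc i"])
  have bL: "L \<le> b" and aL: "L - D \<le> a"
    using decseq_ge[OF dec L(1), of i] decseq_ge[OF dec L(1), of "Suc i"] g(6) by (simp_all add: b_def)
  have ne: "?p \<noteq> P i" "?p \<noteq> E i" "?p \<noteq> E (Suc i)"
  proof -
    have "0 < a" "0 < b" using aL bL L(2) X(2) by linarith+
    then show "?p \<noteq> E i" "?p \<noteq> E (Suc i)" by (simp_all add: a_def b_def)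
    show "?p \<noteq> P i" using g(5) X(2) by (metis dist_self less_irrefl)
  qed
  \<comment> \<open>The curve leaves the vertex along its own segment to the next vertex. Continued by \<open>g'\<close>, this segment
    becomes a geodesic all the way to the evader, with the same germ at the vertex.\<close>
  define k where "k = (\<lambda>s. if s \<le> D then \<gamma> (u + s) else g' s)"
  have w: "geodesic X (\<lambda>s. \<gamma> (u - s)) ?p (P i)"
  proof -
    have "geodesic X (\<lambda>s. \<gamma> (real i * D + s)) (P i) ?p" using C by (simp add: pursuit_curve_def)
    then have "geodesic X (\<lambda>s. \<gamma> (real i * D + (D - s))) ?p (P i)"
      using geodesic_reverse[of X _ "P i" ?p] unfolding g(5) by blast
    then show ?thesis by (simp add: u_def algebra_simps)
  qed
  have h: "geodesic X (\<lambda>r. g (D + r)) ?p (E i)"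
    using geodesic_final_segment[OF g(1,3,4)] g(2) by simp
  have k: "geodesic X k ?p (E (Suc i))"
  proof -
    have "geodesic X (\<lambda>s. \<gamma> (u + s)) ?p (P (Suc (Suc i)))"
      using C unfolding pursuit_curve_def u_def by blast
    from geodesic_replace_initial[OF g'(1) this] g' show ?thesis by (simp add: k_def)
  qed
  have angle: "angle_between (\<lambda>s. \<gamma> (u - s)) k = \<beta>"
  proof -
    have "angle_between (\<lambda>s. \<gamma> (u - s)) k = angle_between (\<lambda>s. \<gamma> (u - s)) (\<lambda>s. \<gamma> (u + s))"
      by (rule angle_between_cong_germ[OF X(2)]) (simp add: k_def)
    then show ?thesis by (simp add: \<beta>_def vertex_angle_def u_def)
  qed
  define c where "c = comparison_cosine ?p (E i) (E (Suc i))"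
  have "dist (P i) (E i) = dist (P i) ?p + dist ?p (E i)" using g by (simp add: a_def)
  from CAT0_turning_angle_le[OF X(1) w h k ne this]
  have \<beta>: "pi - \<beta> \<le> arccos c" "\<beta> \<le> pi" by (simp_all add: angle c_def)
  then show "0 \<le> pi - \<beta>" by simp
  have c: "-1 \<le> c" "c \<le> 1"
    using ne by (simp_all add: c_def comparison_cosine_le_1 comparison_cosine_ge_minus_1)
  define \<delta> where "\<delta> = dist (P i) (E i) - dist ?p (E (Suc i))"
  have \<delta>: "0 \<le> \<delta>" "b - a = D - \<delta>"
    using decseqD[OF dec, of i "Suc i"] g(6) by (auto simp: \<delta>_def b_def)
  have pos: "0 < (L - D) * L" "(L - D) * L \<le> a * b"
    using aL bL L(2) X(2) by (auto intro!: mult_mono)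
  have "1 - c = ((dist (E i) (E (Suc i)))\<^sup>2 - (b - a)\<^sup>2) / (2 * a * b)"
    unfolding c_def one_minus_comparison_cosine[OF ne(2,3)] a_def b_def by (simp add: power2_commute)
  also have "\<dots> \<le> (D\<^sup>2 - (D - \<delta>)\<^sup>2) / (2 * a * b)"
    unfolding \<delta>(2) using g(7) by (intro divide_right_mono diff_right_mono power_mono) (auto simp: a_def b_def)
  also have "\<dots> \<le> (2 * D * \<delta>) / (2 * a * b)"
    by (intro divide_right_mono) (auto simp: a_def b_def power2_eq_square algebra_simps)
  also have "\<dots> = D * \<delta> / (a * b)" by simp
  also have "\<dots> \<le> D * \<delta> / ((L - D) * L)"
    using pos \<delta>(1) X(2) by (intro divide_left_mono) auto
  finally have c_le: "1 - c \<le> D * \<delta> / ((L - D) * L)" .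
  have "(pi - \<beta>)\<^sup>2 \<le> (arccos c)\<^sup>2" using \<beta> by (intro power_mono) auto
  also have "\<dots> \<le> 18 * (1 - c)" by (rule arccos_squared_le[OF c])
  also have "\<dots> \<le> 18 * (D * \<delta> / ((L - D) * L))" using c_le by simp
  finally show "(pi - \<beta>)\<^sup>2 \<le> 18 * D / ((L - D) * L) * (dist (P i) (E i) - dist ?p (E (Suc i)))"
    by (simp add: \<delta>_def)
qed

theorem theorem10:
  fixes X :: "'a::metric_space set" and D :: real
    and P E :: "nat \<Rightarrow> 'a" and \<gamma> :: "real \<Rightarrow> 'a"
  assumes "CAT0 X"
    and "D > 0"
    and "simple_pursuit X D P E"
    and "evader_wins D P E"
    and "pursuit_curve X D P \<gamma>"
  shows "pursuit_total_curvature D \<gamma> \<in> O[at_top](\<lambda>t. t powr (1/2))"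
proof -
  define \<alpha> where "\<alpha> i = pi - vertex_angle \<gamma> (real i * D)" for i
  define len where "len i = dist (P i) (E i)" for i
  obtain L where L: "len \<longlonglongrightarrow> L" "D < L"
    using assms(4) by (auto simp: evader_wins_def len_def[abs_def])
  define K where "K = 18 * D / ((L - D) * L)"
  have K: "0 \<le> K" using L assms(2) by (simp add: K_def)
  have \<alpha>: "0 \<le> \<alpha> (Suc i)" "(\<alpha> (Suc i))\<^sup>2 \<le> K * (len i - len (Suc i))" for i
    using pursuit_turning_angle[OF assms(1-3,5) L[unfolded len_def[abs_def]], of i]
    by (simp_all add: \<alpha>_def len_def K_def)
  have sq: "(pursuit_total_curvature D \<gamma> t)\<^sup>2 \<le> K * len 0 / D * t"
    and nonneg: "0 \<le> pursuit_total_curvature D \<gamma> t" if "t > 0" for t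
  proof -
    \<comment> \<open>The vertices strictly between \<open>0\<close> and \<open>t\<close> are among the first \<open>n \<le> t / D\<close> after the start.\<close>
    define n where "n = nat \<lfloor>t / D\<rfloor>"
    define I where "I = {i. 0 < real i * D \<and> real i * D < t}"
    have I: "I \<subseteq> Suc ` {..<n}"
    proof
      fix i assume "i \<in> I"
      then have i: "0 < i" "real i < t / D"
        using assms(2) by (auto simp: I_def zero_less_mult_iff field_simps)
      then have "i \<le> n" unfolding n_def by linarith
      with i show "i \<in> Suc ` {..<n}" by (cases i) auto
    qed
    have nn: "0 \<le> \<alpha> i" if "i \<in> Suc ` {..<n}" for i using that \<alpha>(1) by auto
    have eq: "pursuit_total_curvature D \<gamma> t = sum \<alpha> I"
      by (simp add: pursuit_total_curvature_def I_def \<alpha>_def)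
    show "0 \<le> pursuit_total_curvature D \<gamma> t" unfolding eq using I nn by (intro sum_nonneg) auto
    then have "(pursuit_total_curvature D \<gamma> t)\<^sup>2 \<le> (sum \<alpha> (Suc ` {..<n}))\<^sup>2"
      unfolding eq using I nn by (intro power_mono sum_mono2) auto
    also have "\<dots> = (\<Sum>i<n. \<alpha> (Suc i))\<^sup>2" by (simp add: sum.reindex)
    also have "\<dots> \<le> (\<Sum>i<n. (\<alpha> (Suc i))\<^sup>2) * n"
      using sum_squared_le_sum_of_squares[of "\<lambda>i. \<alpha> (Suc i)" "{..<n}"] by simp
    also have "\<dots> \<le> (\<Sum>i<n. K * (len i - len (Suc i))) * n"
      by (intro mult_right_mono sum_mono \<alpha>(2)) simp
    also have "(\<Sum>i<n. K * (len i - len (Suc i))) = K * (len 0 - len n)"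
      by (simp add: sum_lessThan_telescope' flip: sum_distrib_left)
    also have "\<dots> * n \<le> K * len 0 * (t / D)"
    proof (rule mult_mono)
      show "K * (len 0 - len n) \<le> K * len 0" using K by (intro mult_left_mono) (simp_all add: len_def)
      show "real n \<le> t / D" using that assms(2) unfolding n_def by simp
    qed (use K in \<open>simp_all add: len_def\<close>)
    finally show "(pursuit_total_curvature D \<gamma> t)\<^sup>2 \<le> K * len 0 / D * t" by simp
  qed
  show ?thesis
  proof (rule bigoI[of _ "sqrt (K * len 0 / D)"], rule eventually_mono[OF eventually_gt_at_top[of 0]])
    fix t :: real assume t: "t > 0"
    have "pursuit_total_curvature D \<gamma> t \<le> sqrt (K * len 0 / D * t)"
      using sq[OF t] by (rule real_le_rsqrt)
    also have "\<dots> = sqrt (K * len 0 / D) * sqrt t" by (rule real_sqrt_mult)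
    finally show "norm (pursuit_total_curvature D \<gamma> t) \<le> sqrt (K * len 0 / D) * norm (t powr (1/2))"
      using nonneg[OF t] t by (simp add: powr_half_sqrt)
  qed
qed

end
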